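(* Let $A \in M_n(\mathbb{C})$ with $\mathrm{rank}(A)=r>0$ be written in a Hartwig-Spindelböck decomposition $$A = U \begin{pmatrix} \Sigma Q & \Sigma P \\ 0 & 0\end{pmatrix} U^{*},$$ let $\tilde{\Sigma} = Q(\Sigma Q)^{d}\,((\Sigma Q)^{d})^{2}$ and $\hat{\Delta} = \tilde{\Sigma}\tilde{\Sigma}^{\dagger}$. Then $A^{\dagger,d,\dagger}$ is an EP matrix if and only if both of the following hold: (i) $Q^{*}\hat{\Delta}Q = \tilde{\Sigma}^{\dagger}\tilde{\Sigma}$; (ii) $\hat{\Delta}P = 0$.
   Context: $M^{\dagger}$ is the Moore-Penrose inverse and $M^{d}$ the Drazin inverse of a (square) matrix $M$. A square matrix $M$ is EP if $MM^{\dagger}=M^{\dagger}M$. The MPDMP matrix associated with $A$ is $A^{\dagger,d,\dagger} := A^{\dagger}A^{d}A^{\dagger}$. In a Hartwig-Spindelböck decomposition of a matrix $A\in M_n(\mathbb{C})$ of rank $r>0$, $U\in M_n(\mathbb{C})$ is unitary, $\Sigma = \mathrm{diag}(\sigma_1 I_{k_1},\dots,\sigma_t I_{k_t})\in M_r(\mathbb{C})$ is diagonal with the nonzero singular values $\sigma_j>0$ of $A$ on the diagonal ($k_1+\dots+k_t=r$), and $Q\in M_r(\mathbb{C})$, $P\in M_{r,n-r}(\mathbb{C})$ satisfy $QQ^{*}+PP^{*}=I_r$. Every nonzero matrix has such a decomposition. *)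

theory Defs
  imports
    "Jordan_Normal_Form.Schur_Decomposition"
    "Jordan_Normal_Form.DL_Rank"
    "HOL-Computational_Algebra.Fundamental_Theorem_Algebra"
begin

abbreviation mat_rank :: "complex mat \<Rightarrow> nat" where
  "mat_rank A \<equiv> vec_space.rank (dim_row A) A"

definition unitary_mat :: "complex mat \<Rightarrow> bool" where
  "unitary_mat U \<longleftrightarrow> square_mat U
     \<and> U * mat_adjoint U = 1\<^sub>m (dim_row U) \<and> mat_adjoint U * U = 1\<^sub>m (dim_row U)"

definition is_moore_penrose :: "complex mat \<Rightarrow> complex mat \<Rightarrow> bool" where
  "is_moore_penrose A X \<longleftrightarrow> X \<in> carrier_mat (dim_col A) (dim_row A)
     \<and> A * X * A = A \<and> X * A * X = X
     \<and> mat_adjoint (A * X) = A * X \<and> mat_adjoint (X * A) = X * A"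

(* Every complex matrix has exactly one Moore-Penrose inverse. *)
definition moore_penrose :: "complex mat \<Rightarrow> complex mat" where
  "moore_penrose A = (THE X. is_moore_penrose A X)"

(* Meant for square matrices; the index of a nonsingular matrix is 0. *)
definition mat_index :: "complex mat \<Rightarrow> nat" where
  "mat_index A = (LEAST k. mat_rank (A ^\<^sub>m k) = mat_rank (A ^\<^sub>m Suc k))"

definition is_drazin :: "complex mat \<Rightarrow> complex mat \<Rightarrow> bool" where
  "is_drazin A X \<longleftrightarrow> X \<in> carrier_mat (dim_row A) (dim_row A)
     \<and> X * A * X = X \<and> A * X = X * A
     \<and> A ^\<^sub>m Suc (mat_index A) * X = A ^\<^sub>m mat_index A"

(* Every square complex matrix has exactly one Drazin inverse. *)
definition drazin :: "complex mat \<Rightarrow> complex mat" where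
  "drazin A = (THE X. is_drazin A X)"

definition EP_mat :: "complex mat \<Rightarrow> bool" where
  "EP_mat M \<longleftrightarrow> square_mat M \<and> M * moore_penrose M = moore_penrose M * M"

definition mpdmp :: "complex mat \<Rightarrow> complex mat" where
  "mpdmp A = moore_penrose A * drazin A * moore_penrose A"

(* Singular values with multiplicity: square roots of the eigenvalues of A^* A,
   which are real and nonnegative, so that Re loses nothing. *)
definition singular_values :: "complex mat \<Rightarrow> real multiset" where
  "singular_values A =
     image_mset (\<lambda>z. sqrt (Re z)) (proots (char_poly (mat_adjoint A * A)))"

(* The list bs consists of the pairs (sigma_j, k_j), j = 1, ..., t. The sigma_j are neither
   required to be pairwise distinct nor to be ordered. *)
definition is_singular_value_diag :: "complex mat \<Rightarrow> complex mat \<Rightarrow> bool" where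
  "is_singular_value_diag A S \<longleftrightarrow> (\<exists>bs :: (real \<times> nat) list.
     (\<forall>(s, k) \<in> set bs. s > 0 \<and> k > 0)
     \<and> S = diag_block_mat (map (\<lambda>(s, k). complex_of_real s \<cdot>\<^sub>m 1\<^sub>m k) bs)
     \<and> (\<Sum>(s, k) \<leftarrow> bs. replicate_mset k s) = filter_mset (\<lambda>s. s \<noteq> 0) (singular_values A))"

definition hartwig_spindelboeck ::
  "nat \<Rightarrow> nat \<Rightarrow> complex mat \<Rightarrow> complex mat \<Rightarrow> complex mat \<Rightarrow> complex mat \<Rightarrow> complex mat \<Rightarrow> bool"
where
  "hartwig_spindelboeck n r A U S Q P \<longleftrightarrow>
     U \<in> carrier_mat n n \<and> unitary_mat U
     \<and> S \<in> carrier_mat r r \<and> is_singular_value_diag A S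
     \<and> Q \<in> carrier_mat r r \<and> P \<in> carrier_mat r (n - r)
     \<and> Q * mat_adjoint Q + P * mat_adjoint P = 1\<^sub>m r
     \<and> A = U * four_block_mat (S * Q) (S * P) (0\<^sub>m (n - r) r) (0\<^sub>m (n - r) (n - r))
             * mat_adjoint U"

end

theory Submission
  imports Defs
begin

text \<open>
  The first \<open>r\<close> columns \<open>E\<close> of \<open>U\<close> and the matrix \<open>F\<close> with \<open>F\<^sup>* = (Q P) U\<^sup>*\<close> are
  isometries with \<open>A = E \<Sigma> F\<^sup>*\<close> and \<open>F\<^sup>* E = Q\<close>. Hence the Moore-Penrose inverse of \<open>A\<close> is
  \<open>F \<Sigma>\<^sup>-\<^sup>1 E\<^sup>*\<close>, and by Cline's formula its Drazin inverse is \<open>E D\<^sup>2 \<Sigma> F\<^sup>*\<close> with \<open>D\<close> the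
  Drazin inverse of \<open>\<Sigma> Q\<close>; their product collapses to \<open>F T E\<^sup>*\<close> with \<open>T = Q D\<^sup>3\<close>. Since
  Moore-Penrose inversion commutes with isometries, EP means \<open>F \<Delta> F\<^sup>* = E T\<^sup>\<dagger> T E\<^sup>*\<close>.
  Compressing this by \<open>E\<^sup>*\<close> on the left and \<open>E\<close> on the right gives (i), and by \<open>F\<^sup>*\<close> and the
  remaining columns \<open>G\<close> of \<open>U\<close> gives (ii). Conversely (ii) means \<open>\<Delta> F\<^sup>* = \<Delta> Q E\<^sup>*\<close>.
\<close>

section \<open>Drazin inverses in a monoid\<close>

text \<open>Multiplying on the left by the missing power of \<open>a\<close> carries the equation
  upwards; this brings different exponents to a common one.\<close>

lemma (in monoid) pow_drop:
  fixes k m :: nat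
  assumes "a \<in> carrier G" "x \<in> carrier G" and "a [^] Suc k \<otimes> x = a [^] k" and "k \<le> m"
  shows "a [^] Suc m \<otimes> x = a [^] m"
proof -
  obtain d where d: "m = d + k" using \<open>k \<le> m\<close> by (metis le_iff_add add.commute)
  have "a [^] Suc m = a [^] d \<otimes> a [^] Suc k"
    using assms(1) by (simp only: nat_pow_mult d add_Suc_right)
  then have "a [^] Suc m \<otimes> x = a [^] d \<otimes> (a [^] Suc k \<otimes> x)"
    using assms(1,2) by (simp only: m_assoc nat_pow_closed)
  then show ?thesis using assms by (simp only: nat_pow_mult d)
qed

text \<open>Each factor \<open>y\<close> absorbs one factor \<open>a\<close>. With
  \<open>j = Suc k\<close> this gives \<open>a^(2k+1) y^(k+1) = a^k\<close>, on which the existence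
  proof rests.\<close>

lemma (in monoid) pow_iterate_right:
  fixes k :: nat
  assumes a: "a \<in> carrier G" and y: "y \<in> carrier G" and h: "a [^] k = a [^] Suc k \<otimes> y"
  shows "a [^] (k + j) \<otimes> y [^] j = a [^] k"
proof (induction j)
  case (Suc j)
  have "a [^] (k + Suc j) \<otimes> y [^] Suc j = a [^] Suc (k + j) \<otimes> y \<otimes> y [^] j"
    using a y by (simp only: nat_pow_Suc2[OF y, of j] m_assoc nat_pow_closed m_closed add_Suc_right)
  also have "a [^] Suc (k + j) \<otimes> y = a [^] (k + j)"
    using pow_drop[OF a y h[symmetric]] by simp
  finally show ?case using Suc by simp
qed (use a in simp)

lemma (in monoid) pow_iterate_left:
  fixes k :: nat
  assumes a: "a \<in> carrier G" and z: "z \<in> carrier G" and h: "a [^] k = z \<otimes> a [^] Suc k"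
  shows "z [^] j \<otimes> a [^] (k + j) = a [^] k"
proof (induction j)
  case (Suc j)
  have "a [^] (k + Suc j) = a [^] Suc k \<otimes> a [^] j"
    using a by (simp only: nat_pow_mult add_Suc add_Suc_right)
  then have "z [^] Suc j \<otimes> a [^] (k + Suc j) = z [^] j \<otimes> (z \<otimes> a [^] Suc k \<otimes> a [^] j)"
    using a z by (simp add: m_assoc del: nat_pow_Suc add: nat_pow_Suc[of z])
  also have "\<dots> = z [^] j \<otimes> a [^] (k + j)"
    using a by (simp only: h[symmetric] nat_pow_mult)
  finally show ?case using Suc by simp
qed (use a in simp)

lemma (in monoid) pow_commute:
  fixes j :: nat
  assumes a: "a \<in> carrier G" and x: "x \<in> carrier G" and ax: "a \<otimes> x = x \<otimes> a"
  shows "a [^] j \<otimes> x = x \<otimes> a [^] j"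
proof (induction j)
  case (Suc j)
  have "a [^] Suc j \<otimes> x = a [^] j \<otimes> x \<otimes> a" using a x ax by (simp add: m_assoc)
  then show ?case using a x by (simp add: Suc m_assoc)
qed (use x in simp)

lemma (in monoid) pow_drop_left:
  fixes k m :: nat
  assumes a: "a \<in> carrier G" and z: "z \<in> carrier G" and h: "z \<otimes> a [^] Suc k = a [^] k" and "k \<le> m"
  shows "z \<otimes> a [^] Suc m = a [^] m"
proof -
  obtain d where d: "m = k + d" using \<open>k \<le> m\<close> by (metis le_iff_add)
  have "a [^] Suc m = a [^] Suc k \<otimes> a [^] d"
    using a by (simp only: nat_pow_mult d add_Suc)
  then have "z \<otimes> a [^] Suc m = z \<otimes> a [^] Suc k \<otimes> a [^] d"
    using a z by (simp only: m_assoc nat_pow_closed)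
  then show ?thesis using a by (simp only: h nat_pow_mult d)
qed

text \<open>Writing \<open>a^k\<close> as \<open>a^(k+m) y^m\<close> raises the exponent to at least
  \<open>m\<close>, where \<open>x\<close> cancels against one \<open>a\<close>; \<open>x\<close>
  reaches that power because it commutes with \<open>a\<close>.\<close>

lemma (in monoid) drazin_exponent_descend:
  fixes k m :: nat
  assumes a: "a \<in> carrier G" and x: "x \<in> carrier G" and y: "y \<in> carrier G"
    and hy: "a [^] k = a [^] Suc k \<otimes> y"
    and ax: "a \<otimes> x = x \<otimes> a" and am: "a [^] Suc m \<otimes> x = a [^] m"
  shows "a [^] Suc k \<otimes> x = a [^] k"
proof -
  have it: "a [^] (k + m) \<otimes> y [^] m = a [^] k" by (rule pow_iterate_right[OF a y hy])
  have "a [^] Suc k \<otimes> x = x \<otimes> a [^] Suc k" by (rule pow_commute[OF a x ax])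
  also have "\<dots> = x \<otimes> (a \<otimes> (a [^] (k + m) \<otimes> y [^] m))"
    using a by (simp only: nat_pow_Suc2 it)
  also have "\<dots> = x \<otimes> a [^] Suc (k + m) \<otimes> y [^] m"
    using a x y by (simp only: m_assoc nat_pow_closed m_closed nat_pow_Suc2[OF a, of "k + m"])
  also have "x \<otimes> a [^] Suc (k + m) = a [^] Suc (k + m) \<otimes> x"
    by (rule pow_commute[OF a x ax, symmetric])
  also have "\<dots> = a [^] (k + m)" by (rule pow_drop[OF a x am]) simp
  finally show ?thesis by (simp only: it)
qed

text \<open>Drazin's criterion (strong pi-regularity): the inverse is \<open>a^k y^(k+1)\<close>,
  which also equals \<open>z^(k+1) a^k\<close>. Having both forms is what yields commutation with
  \<open>a\<close>.\<close>

lemma (in monoid) drazin_inverse_exists: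
  fixes k :: nat
  assumes a: "a \<in> carrier G" and y: "y \<in> carrier G" and z: "z \<in> carrier G"
    and hy: "a [^] k = a [^] Suc k \<otimes> y" and hz: "a [^] k = z \<otimes> a [^] Suc k"
  shows "\<exists>x \<in> carrier G. x \<otimes> a \<otimes> x = x \<and> a \<otimes> x = x \<otimes> a \<and> a [^] Suc k \<otimes> x = a [^] k"
proof -
  define p where "p = a [^] k"
  define u where "u = y [^] Suc k"
  define w where "w = z [^] Suc k"
  have c: "p \<in> carrier G" "u \<in> carrier G" "w \<in> carrier G"
    using a y z by (simp_all add: p_def u_def w_def del: nat_pow_Suc)
  have pa: "p \<otimes> a = a \<otimes> p"
    using a by (simp add: p_def nat_pow_Suc2[symmetric])
  have s: "a [^] Suc k = p \<otimes> a" by (simp add: p_def)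
  have "a [^] (k + Suc k) = p \<otimes> (p \<otimes> a)"
    using a by (simp only: p_def s[symmetric] nat_pow_mult flip: nat_pow_Suc)
  then have 1: "p \<otimes> (p \<otimes> a) \<otimes> u = p" and 2: "w \<otimes> (p \<otimes> (p \<otimes> a)) = p"
    using pow_iterate_right[OF a y hy, of "Suc k"] pow_iterate_left[OF a z hz, of "Suc k"]
    by (simp_all add: p_def u_def w_def del: nat_pow_Suc add_Suc_right)
  define x where "x = p \<otimes> u"
  have x: "x \<in> carrier G" using c by (simp add: x_def)
  have pau: "p \<otimes> (a \<otimes> x) = p"
    using 1 a c pa by (simp add: x_def m_assoc flip: m_assoc)
  \<comment> \<open>The product \<open>w p p a u\<close> reduces to \<open>w p\<close> from the
    right and to \<open>p u\<close> from the left.\<close>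
  have xw: "x = w \<otimes> p"
  proof -
    have "w \<otimes> p = w \<otimes> (p \<otimes> (p \<otimes> a) \<otimes> u)" by (simp only: 1)
    also have "\<dots> = w \<otimes> (p \<otimes> (p \<otimes> a)) \<otimes> u" using a c by (simp add: m_assoc)
    finally show ?thesis by (simp add: 2 x_def)
  qed
  have xap: "x \<otimes> a \<otimes> p = p"
    using 2 a c by (simp add: xw m_assoc flip: pa)
  have comm: "a \<otimes> x = x \<otimes> a"
  proof -
    have "a \<otimes> x = a \<otimes> p \<otimes> u" using a c by (simp add: x_def m_assoc)
    also have "\<dots> = p \<otimes> a \<otimes> u" by (simp only: pa)
    also have "\<dots> = x \<otimes> a \<otimes> p \<otimes> a \<otimes> u" by (simp only: xap)
    also have "\<dots> = w \<otimes> (p \<otimes> a \<otimes> p \<otimes> a \<otimes> u)" using a c by (simp add: xw m_assoc)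
    also have "p \<otimes> a \<otimes> p \<otimes> a \<otimes> u = a \<otimes> (p \<otimes> (p \<otimes> a) \<otimes> u)"
    proof -
      have "p \<otimes> a \<otimes> p = a \<otimes> p \<otimes> p" by (simp only: pa)
      then show ?thesis using a c by (simp add: m_assoc)
    qed
    also have "\<dots> = p \<otimes> a" by (simp only: 1) (simp only: pa)
    finally show ?thesis using a c by (simp add: xw m_assoc)
  qed
  have "x \<otimes> a \<otimes> x = w \<otimes> (p \<otimes> (a \<otimes> x))" using a c x by (simp add: xw m_assoc)
  also have "\<dots> = x" by (simp only: pau) (simp only: xw)
  finally have xax: "x \<otimes> a \<otimes> x = x" .
  have "a [^] Suc k \<otimes> x = a [^] k"
    using pau a c x by (simp add: s p_def m_assoc)
  then show ?thesis using x xax comm by blast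
qed

text \<open>Commutation and \<open>v a v = v\<close> give \<open>v = a^j v^(j+1)\<close> for every
  \<open>j\<close>, so each inverse can be expanded with the exponent of the other. Both then
  collapse to \<open>y a x\<close>.\<close>

lemma (in monoid) drazin_inverse_unique:
  fixes k l :: nat
  assumes a: "a \<in> carrier G" and x: "x \<in> carrier G" and y: "y \<in> carrier G"
    and xax: "x \<otimes> a \<otimes> x = x" and ax: "a \<otimes> x = x \<otimes> a" and axk: "a [^] Suc k \<otimes> x = a [^] k"
    and yay: "y \<otimes> a \<otimes> y = y" and ay: "a \<otimes> y = y \<otimes> a" and ayl: "a [^] Suc l \<otimes> y = a [^] l"
  shows "x = y"
proof -
  have pw_right: "a [^] j \<otimes> v [^] Suc j = v"
    if v: "v \<in> carrier G" "a \<otimes> v = v \<otimes> a" "v \<otimes> a \<otimes> v = v" for v and j :: nat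
  proof (induction j)
    case (Suc j)
    have "a [^] Suc j \<otimes> v [^] Suc (Suc j) = a \<otimes> (a [^] j \<otimes> v [^] Suc j) \<otimes> v"
      using a v(1) by (simp only: nat_pow_Suc2[OF a, of j] m_assoc nat_pow_closed m_closed nat_pow_Suc[of v])
    then show ?case by (simp only: Suc v)
  qed (use v in simp)
  have pw_left: "v [^] Suc j \<otimes> a [^] j = v"
    if v: "v \<in> carrier G" "a \<otimes> v = v \<otimes> a" "v \<otimes> a \<otimes> v = v" for v and j :: nat
  proof (induction j)
    case (Suc j)
    have "v [^] Suc (Suc j) \<otimes> a [^] Suc j = v \<otimes> (v [^] Suc j \<otimes> a [^] j) \<otimes> a"
      using a v(1) by (simp only: nat_pow_Suc2[OF v(1), of "Suc j"] m_assoc nat_pow_closed m_closed nat_pow_Suc[of a])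
    also have "\<dots> = v \<otimes> a \<otimes> v"
      using a v(1) by (simp only: Suc m_assoc v(2))
    finally show ?case by (simp only: v)
  qed (use v in simp)
  \<comment> \<open>The exponent \<open>l\<close> belongs to \<open>y\<close>, so
    \<open>a^l = a^(l+1) y\<close> can be substituted in the expansion of \<open>x\<close>.\<close>
  have "x = a [^] Suc l \<otimes> y \<otimes> x [^] Suc l" using pw_right[OF x ax xax, of l] by (simp only: ayl)
  also have "\<dots> = y \<otimes> a [^] Suc l \<otimes> x [^] Suc l" using pow_commute[OF a y ay, of "Suc l"] by (simp only:)
  also have "\<dots> = y \<otimes> a \<otimes> (a [^] l \<otimes> x [^] Suc l)"
    using a x y by (simp only: nat_pow_Suc2[OF a, of l] m_assoc nat_pow_closed m_closed)
  finally have 1: "x = y \<otimes> a \<otimes> x" by (simp only: pw_right[OF x ax xax])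
  have "y = y [^] Suc k \<otimes> a [^] k" by (simp only: pw_left[OF y ay yay])
  also have "\<dots> = y [^] Suc k \<otimes> (a [^] Suc k \<otimes> x)" by (simp only: axk)
  also have "\<dots> = y [^] Suc k \<otimes> a [^] k \<otimes> a \<otimes> x"
    using a x y by (simp only: m_assoc nat_pow_closed m_closed nat_pow_Suc[of a])
  finally have "y = y \<otimes> a \<otimes> x" by (simp only: pw_left[OF y ay yay])
  with 1 show ?thesis by simp
qed

section \<open>Rank and index\<close>

text \<open>The columns of \<open>A * B\<close> lie in the column space of \<open>A\<close>. If the
  ranks agree, the two column spaces coincide by dimension, and \<open>Y\<close> collects the
  coefficients of the columns of \<open>A\<close> in terms of those of \<open>A * B\<close>.\<close>

lemma (in vec_space) rank_mult_le:
  assumes A: "A \<in> carrier_mat n m" and B: "B \<in> carrier_mat m k"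
  shows "rank (A * B) \<le> rank A"
    and "rank (A * B) = rank A \<Longrightarrow> \<exists>Y \<in> carrier_mat k m. A = A * B * Y"
proof -
  let ?W = "span (set (cols A))" and ?C = "set (cols (A * B))"
  have AB: "A * B \<in> carrier_mat n k" using A B by simp
  have cA: "set (cols A) \<subseteq> carrier_vec n" and cAB: "?C \<subseteq> carrier_vec n"
    using A AB cols_dim by blast+
  have sub: "?C \<subseteq> ?W"
  proof
    fix v assume "v \<in> ?C"
    then obtain j where j: "j < k" "v = col (A * B) j"
      using AB by (auto simp: cols_def)
    then have "v = A *\<^sub>v col B j" using A B by auto
    also have "\<dots> = mat_of_cols n (cols A) *\<^sub>v vec (length (cols A)) (\<lambda>i. col B j $ i)"
      using A B j mat_of_cols_cols[of A] by (intro arg_cong2[where f = "(*\<^sub>v)"]) auto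
    also have "\<dots> = lincomb_list (\<lambda>i. col B j $ i) (cols A)"
      using cA by (intro lincomb_list_as_mat_mult[symmetric]) auto
    finally have "v \<in> span_list (cols A)" by (auto simp: span_list_def)
    then show "v \<in> ?W" using span_list_as_span[OF cA] by simp
  qed
  have smod: "submodule class_ring ?W V" using cA span_is_submodule by simp
  interpret W: vectorspace class_ring "vs ?W"
    using cA span_is_subspace subspace_is_vs by simp
  have fW: "W.fin_dim" by (rule fin_dim_span_cols[OF A])
  \<comment> \<open>The rank of \<open>A * B\<close> is the size of a maximal independent set of its
    columns.\<close>
  obtain S where S: "finite S" "maximal S (\<lambda>T. T \<subseteq> ?C \<and> lin_indpt T)"
    using maximal_exists_superset[of ?C "\<lambda>T. T \<subseteq> ?C \<and> lin_indpt T" "{}"]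
    by (auto simp: lin_dep_def)
  then have SC: "S \<subseteq> ?C" and li: "lin_indpt S" by (auto simp: maximal_def)
  have rS: "rank (A * B) = card S" using rank_card_indpt[OF AB S(2)] .
  have SW: "S \<subseteq> ?W" using SC sub by blast
  have liW: "W.lin_indpt S" using span_li_not_depend(2)[OF SW smod] li by simp
  show "rank (A * B) \<le> rank A"
    using W.li_le_dim(2)[OF fW _ liW] SW unfolding rS by (simp add: rank_def)
  assume eq: "rank (A * B) = rank A"
  \<comment> \<open>As many independent vectors as the dimension of the column space of
    \<open>A\<close> form a basis of it.\<close>
  have "W.basis S"
    using W.dim_li_is_basis[OF fW S(1) _ liW] SW eq unfolding rS by (simp add: rank_def)
  then have "span S = ?W"
    using span_li_not_depend(1)[OF SW smod] by (simp add: W.basis_def)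
  then have WC: "?W \<subseteq> span ?C" using SC by (metis span_is_monotone)
  have colA: "col A j \<in> span_list (cols (A * B))" if "j < m" for j
  proof -
    have "col A j \<in> set (cols A)" using that A by (auto simp: cols_def)
    moreover have "set (cols A) \<subseteq> ?W" using cA by (intro in_own_span) simp
    ultimately have "col A j \<in> span ?C" using WC by (meson subsetD)
    then show ?thesis using span_list_as_span[OF cAB] by simp
  qed
  have "\<exists>c. col A j = (A * B) *\<^sub>v vec k c" if "j < m" for j
  proof -
    obtain c where "col A j = lincomb_list c (cols (A * B))"
      using colA[OF \<open>j < m\<close>] by (auto simp: span_list_def)
    also have "\<dots> = mat_of_cols n (cols (A * B)) *\<^sub>v vec (length (cols (A * B))) c"
      using cAB by (intro lincomb_list_as_mat_mult) auto
    also have "\<dots> = (A * B) *\<^sub>v vec k c"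
      using A B mat_of_cols_cols[of "A * B"] by simp
    finally show ?thesis by blast
  qed
  then obtain c where c: "\<And>j. j < m \<Longrightarrow> col A j = (A * B) *\<^sub>v vec k (c j)" by metis
  define Y where "Y = mat k m (\<lambda>(i, j). c j i)"
  have Y: "Y \<in> carrier_mat k m" by (simp add: Y_def)
  have "A = A * B * Y"
  proof (rule mat_col_eqI)
    fix j assume "j < dim_col (A * B * Y)"
    then have j: "j < m" using Y by simp
    have "col Y j = vec k (c j)" using j by (auto simp: Y_def col_def)
    then show "col A j = col (A * B * Y) j"
      by (simp only: c[OF j] col_mult2[OF AB Y j])
  qed (use A AB Y in auto)
  then show "\<exists>Y \<in> carrier_mat k m. A = A * B * Y" using Y by blast
qed

text \<open>Otherwise the ranks would decrease strictly for ever. Hence the \<open>LEAST\<close> in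
  \<open>mat_index\<close> is attained.\<close>

lemma rank_pow_stabilises:
  assumes A: "(A :: complex mat) \<in> carrier_mat n n"
  shows "\<exists>k. mat_rank (A ^\<^sub>m k) = mat_rank (A ^\<^sub>m Suc k)"
proof (rule ccontr)
  assume ne: "\<not> ?thesis"
  let ?r = "\<lambda>k. vec_space.rank n (A ^\<^sub>m k)"
  have step: "?r (Suc k) < ?r k" for k
  proof -
    have "?r (Suc k) \<le> ?r k" using vec_space.rank_mult_le(1)[of "A ^\<^sub>m k" n n A n] A by simp
    moreover have "?r k \<noteq> ?r (Suc k)" using ne A by (auto simp del: pow_mat.simps)
    ultimately show ?thesis by simp
  qed
  have "?r k + k \<le> ?r 0" for k
  proof (induction k)
    case (Suc k)
    then show ?case using step[of k] by linarith
  qed simp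
  from this[of "Suc (?r 0)"] show False by simp
qed

lemma rank_mat_index:
  assumes "A \<in> carrier_mat n n"
  shows "mat_rank (A ^\<^sub>m mat_index A) = mat_rank (A ^\<^sub>m Suc (mat_index A))"
  unfolding mat_index_def by (rule LeastI_ex[OF rank_pow_stabilises[OF assms]])

text \<open>Turns the equality of ranks at the index into the right factorization that the monoid
  lemmas assume.\<close>

lemma pow_mat_index_factor:
  assumes A: "A \<in> carrier_mat n n"
  shows "\<exists>Y \<in> carrier_mat n n. A ^\<^sub>m mat_index A = A ^\<^sub>m Suc (mat_index A) * Y"
  using vec_space.rank_mult_le(2)[of "A ^\<^sub>m mat_index A" n n A n] rank_mat_index[OF A] A by simp

text \<open>Side conditions on dimensions, rather than carriers, leave no sizes to be guessed when
  rewriting.\<close>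

lemma mult_mat_assoc:
  assumes "dim_col A = dim_row B" and "dim_col B = dim_row C"
  shows "(A :: 'a :: semiring_0 mat) * B * C = A * (B * C)"
  using assms by (intro assoc_mult_mat) auto

section \<open>Powers of square matrices\<close>

lemma pow_mat_Suc2:
  assumes A: "(A :: 'a :: semiring_1 mat) \<in> carrier_mat n n"
  shows "A ^\<^sub>m Suc k = A * A ^\<^sub>m k"
proof (induction k)
  case (Suc k)
  have "A ^\<^sub>m Suc (Suc k) = A * A ^\<^sub>m k * A" by (simp only: pow_mat.simps(2)[of A "Suc k"] Suc)
  also have "\<dots> = A * A ^\<^sub>m Suc k" using A by (simp add: mult_mat_assoc)
  finally show ?case .
qed (use A in simp)

lemma pow_mat_transpose:
  assumes A: "(A :: 'a :: comm_semiring_1 mat) \<in> carrier_mat n n"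
  shows "(A ^\<^sub>m k)\<^sup>T = A\<^sup>T ^\<^sub>m k"
proof (induction k)
  case (Suc k)
  have "(A ^\<^sub>m Suc k)\<^sup>T = A\<^sup>T * A\<^sup>T ^\<^sub>m k"
    using A Suc by (simp add: transpose_mult[of _ n n _ n])
  also have "\<dots> = A\<^sup>T ^\<^sub>m Suc k"
    using A by (intro pow_mat_Suc2[of _ n, symmetric]) simp
  finally show ?case .
qed (use A in simp)

section \<open>Drazin inverses of matrices\<close>

text \<open>The definition fixes the exponent to be the index; the factorization at the index allows
  the equation to be checked at any convenient \<open>m\<close>.\<close>

lemma is_drazinI:
  assumes A: "A \<in> carrier_mat n n" and X: "X \<in> carrier_mat n n"
    and XAX: "X * A * X = X" and AX: "A * X = X * A" and m: "A ^\<^sub>m Suc m * X = A ^\<^sub>m m"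
  shows "is_drazin A X"
proof -
  \<comment> \<open>In the monoid of \<open>n\<close> by \<open>n\<close> matrices the monoid power
    is \<open>pow_mat\<close>; powers are kept folded so that the general lemmas match.\<close>
  interpret monoid "ring_mat TYPE(complex) n ()"
    by (intro ring.is_monoid ring_mat)
  obtain Y where Y: "Y \<in> carrier_mat n n" "A ^\<^sub>m mat_index A = A ^\<^sub>m Suc (mat_index A) * Y"
    using pow_mat_index_factor[OF A] by blast
  note [simp del] = pow_mat.simps nat_pow_Suc Group.nat_pow_Suc
  have "A ^\<^sub>m Suc (mat_index A) * X = A ^\<^sub>m mat_index A"
    using drazin_exponent_descend[of A X Y "mat_index A" m] A X Y AX m
    by (simp add: ring_mat_simps flip: pow_mat_ring_pow[OF A, of _ "()"])
  then show ?thesis using A X XAX AX by (simp add: is_drazin_def)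
qed

lemma is_drazin_unique:
  assumes A: "A \<in> carrier_mat n n" and X: "is_drazin A X" and Y: "is_drazin A Y"
  shows "X = Y"
proof -
  interpret monoid "ring_mat TYPE(complex) n ()"
    by (intro ring.is_monoid ring_mat)
  note [simp del] = pow_mat.simps nat_pow_Suc Group.nat_pow_Suc
  show ?thesis
    using drazin_inverse_unique[of A X Y "mat_index A" "mat_index A"] A X Y
    by (simp add: is_drazin_def ring_mat_simps del: assoc_mult_mat flip: pow_mat_ring_pow[OF A, of _ "()"])
qed

text \<open>The left factorization comes from the right one for the transpose. Instead of comparing
  the indices of \<open>A\<close> and its transpose, their maximum serves as common
  exponent.\<close>

lemma is_drazin_exists:
  assumes A: "A \<in> carrier_mat n n"
  shows "\<exists>X. is_drazin A X"
proof -
  interpret monoid "ring_mat TYPE(complex) n ()"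
    by (intro ring.is_monoid ring_mat)
  let ?k = "mat_index A" and ?l = "mat_index A\<^sup>T"
  note [simp del] = pow_mat.simps nat_pow_Suc Group.nat_pow_Suc
  have At: "A\<^sup>T \<in> carrier_mat n n" using A by simp
  obtain Y where Y: "Y \<in> carrier_mat n n" "A ^\<^sub>m ?k = A ^\<^sub>m Suc ?k * Y"
    using pow_mat_index_factor[OF A] by blast
  obtain Z where Z: "Z \<in> carrier_mat n n" "A\<^sup>T ^\<^sub>m ?l = A\<^sup>T ^\<^sub>m Suc ?l * Z"
    using pow_mat_index_factor[OF At] by blast
  have "A ^\<^sub>m ?l = (A\<^sup>T ^\<^sub>m Suc ?l * Z)\<^sup>T"
    using pow_mat_transpose[OF A, of ?l] Z(2) by (metis transpose_transpose)
  also have "\<dots> = Z\<^sup>T * A ^\<^sub>m Suc ?l"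
    using Z(1) A by (simp add: transpose_mult[of _ n n _ n] flip: pow_mat_transpose[OF A])
  finally have Zt: "Z\<^sup>T * A ^\<^sub>m Suc ?l = A ^\<^sub>m ?l" ..
  let ?m = "max ?k ?l"
  have "A ^\<^sub>m Suc ?m * Y = A ^\<^sub>m ?m" "Z\<^sup>T * A ^\<^sub>m Suc ?m = A ^\<^sub>m ?m"
    using pow_drop[of A Y ?k ?m] pow_drop_left[of A "Z\<^sup>T" ?l ?m] A Y Z(1) Zt
    by (simp_all add: ring_mat_simps flip: pow_mat_ring_pow[OF A, of _ "()"])
  then obtain X where "X \<in> carrier_mat n n" "X * A * X = X" "A * X = X * A" "A ^\<^sub>m Suc ?m * X = A ^\<^sub>m ?m"
    using drazin_inverse_exists[of A Y "Z\<^sup>T" ?m] A Y(1) Z(1)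
    by (auto simp add: ring_mat_simps simp flip: pow_mat_ring_pow[OF A, of _ "()"])
  then show ?thesis using is_drazinI[OF A] by blast
qed

lemma drazin_eqI:
  assumes "A \<in> carrier_mat n n" and "is_drazin A X"
  shows "drazin A = X"
  unfolding drazin_def using assms is_drazin_unique by blast

lemma is_drazin_drazin:
  assumes "A \<in> carrier_mat n n"
  shows "is_drazin A (drazin A)"
  using is_drazin_exists[OF assms] drazin_eqI[OF assms] by auto

(* Cline's formula. *)
lemma drazin_mult_swap:
  assumes X: "X \<in> carrier_mat n r" and Y: "Y \<in> carrier_mat r n"
  shows "drazin (X * Y) = X * (drazin (Y * X) * drazin (Y * X)) * Y"
proof (rule drazin_eqI)
  define B where "B = Y * X"
  define D where "D = drazin B"
  define m where "m = mat_index B"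
  have B: "B \<in> carrier_mat r r" using X Y by (simp add: B_def)
  have D: "D \<in> carrier_mat r r" and DBD: "D * B * D = D" and BD: "B * D = D * B"
    and Bm: "B ^\<^sub>m Suc m * D = B ^\<^sub>m m"
    using is_drazin_drazin[OF B] B by (auto simp: is_drazin_def D_def m_def simp del: pow_mat.simps)
  note car = X Y B D
  note ass = mult_mat_assoc
  \<comment> \<open>A factor \<open>B\<close> beside \<open>D * D\<close> removes one
    \<open>D\<close>, on either side; the products below reduce to these two identities.\<close>
  have BDD: "B * (D * D) = D" using DBD car by (simp add: ass flip: BD)
  have DDB: "D * D * B = D" using DBD BD car by (simp add: ass)
  show "X * Y \<in> carrier_mat n n" using car by simp
  have "is_drazin (X * Y) (X * (D * D) * Y)"
  proof (rule is_drazinI)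
    show "X * Y \<in> carrier_mat n n" "X * (D * D) * Y \<in> carrier_mat n n" using car by auto
    have 1: "X * Y * (X * (D * D) * Y) = X * D * Y"
    proof -
      have "X * Y * (X * (D * D) * Y) = X * (B * (D * D)) * Y"
        using car by (simp add: B_def ass del: assoc_mult_mat)
      then show ?thesis by (simp only: BDD)
    qed
    have 2: "X * (D * D) * Y * (X * Y) = X * D * Y"
    proof -
      have "X * (D * D) * Y * (X * Y) = X * (D * D * B) * Y"
        using car by (simp add: B_def ass del: assoc_mult_mat)
      then show ?thesis by (simp only: DDB)
    qed
    show "X * Y * (X * (D * D) * Y) = X * (D * D) * Y * (X * Y)" by (simp only: 1 2)
    have "X * (D * D) * Y * (X * Y) * (X * (D * D) * Y) = X * (D * (B * (D * D))) * Y"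
      using car by (simp only: 2) (simp add: B_def ass del: assoc_mult_mat)
    then show "X * (D * D) * Y * (X * Y) * (X * (D * D) * Y) = X * (D * D) * Y" by (simp only: BDD)
    \<comment> \<open>Regrouping the alternating product leaves one \<open>X\<close> and one
      \<open>Y\<close> outside, so the exponent for \<open>X * Y\<close> is one more than the index
      of \<open>Y * X\<close>.\<close>
    have pow: "(X * Y) ^\<^sub>m Suc j = X * B ^\<^sub>m j * Y" for j
    proof (induction j)
      case (Suc j)
      have "(X * Y) ^\<^sub>m Suc (Suc j) = X * B ^\<^sub>m j * Y * (X * Y)"
        using Suc by (simp only: pow_mat.simps(2)[of _ "Suc j"])
      also have "\<dots> = X * (B ^\<^sub>m j * B) * Y"
        using car by (simp add: B_def ass del: assoc_mult_mat)
      finally show ?case by simp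
    qed (use car in simp)
    have "(X * Y) ^\<^sub>m Suc (Suc m) * (X * (D * D) * Y) = X * (B ^\<^sub>m Suc m * (B * (D * D))) * Y"
      unfolding pow using car by (simp add: B_def ass del: assoc_mult_mat pow_mat.simps)
    also have "\<dots> = X * B ^\<^sub>m m * Y" by (simp only: BDD Bm)
    finally show "(X * Y) ^\<^sub>m Suc (Suc m) * (X * (D * D) * Y) = (X * Y) ^\<^sub>m Suc m"
      by (simp only: pow)
  qed
  then show "is_drazin (X * Y) (X * (drazin (Y * X) * drazin (Y * X)) * Y)"
    by (simp add: B_def D_def)
qed

section \<open>Moore-Penrose inverses\<close>

lemma dim_mat_adjoint [simp]:
  "dim_row (mat_adjoint A) = dim_col A" "dim_col (mat_adjoint A) = dim_row A"
  by (auto simp: mat_adjoint_def)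

lemma mat_adjoint_carrier [simp]:
  "A \<in> carrier_mat n m \<Longrightarrow> mat_adjoint A \<in> carrier_mat m n"
  by (intro carrier_matI) auto

lemma index_mat_adjoint [simp]:
  "i < dim_col A \<Longrightarrow> j < dim_row A \<Longrightarrow> mat_adjoint A $$ (i, j) = conjugate (A $$ (j, i))"
  by (simp add: mat_adjoint_def mat_of_rows_index)

lemma mat_adjoint_adjoint [simp]: "mat_adjoint (mat_adjoint A) = A"
  by (intro eq_matI) auto

lemma mat_adjoint_one [simp]: "mat_adjoint (1\<^sub>m n :: complex mat) = 1\<^sub>m n"
  by (intro eq_matI) auto

lemma mat_adjoint_add:
  "dim_row A = dim_row B \<Longrightarrow> dim_col A = dim_col B \<Longrightarrow>
    mat_adjoint (A + B :: complex mat) = mat_adjoint A + mat_adjoint B"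
  by (intro eq_matI) auto

lemma mat_adjoint_mult:
  assumes "dim_col A = dim_row B"
  shows "mat_adjoint (A * B :: complex mat) = mat_adjoint B * mat_adjoint A"
  using assms by (intro eq_matI) (auto simp: scalar_prod_def mult.commute)

lemma mat_adjoint_pow:
  assumes "A \<in> carrier_mat n n"
  shows "mat_adjoint (A ^\<^sub>m k :: complex mat) = mat_adjoint A ^\<^sub>m k"
proof (induction k)
  case (Suc k)
  have "mat_adjoint (A ^\<^sub>m Suc k) = mat_adjoint A * mat_adjoint A ^\<^sub>m k"
    using assms Suc by (simp add: mat_adjoint_mult)
  also have "\<dots> = mat_adjoint A ^\<^sub>m Suc k"
    using assms by (intro pow_mat_Suc2[of _ n, symmetric]) simp
  finally show ?case .
qed (use assms in simp)

text \<open>A diagonal entry of \<open>A^* A\<close> is the sum of the squared moduli in one column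
  of \<open>A\<close>.\<close>

lemma mat_adjoint_mult_self_eq_0:
  assumes "mat_adjoint A * A = 0\<^sub>m (dim_col A) (dim_col A)"
  shows "(A :: complex mat) = 0\<^sub>m (dim_row A) (dim_col A)"
proof (rule eq_matI)
  fix i j assume "i < dim_row (0\<^sub>m (dim_row A) (dim_col A) :: complex mat)"
    and "j < dim_col (0\<^sub>m (dim_row A) (dim_col A) :: complex mat)"
  then have ij: "i < dim_row A" "j < dim_col A" by auto
  have "complex_of_real (\<Sum>k<dim_row A. (cmod (A $$ (k, j)))\<^sup>2) = (mat_adjoint A * A) $$ (j, j)"
    using ij by (simp add: scalar_prod_def complex_norm_square mult.commute lessThan_atLeast0
        del: of_real_power)
  then have "(\<Sum>k<dim_row A. (cmod (A $$ (k, j)))\<^sup>2) = 0"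
    using ij assms by (metis index_zero_mat(1) of_real_eq_0_iff)
  then have "(cmod (A $$ (i, j)))\<^sup>2 = 0"
    using ij by (subst (asm) sum_nonneg_eq_0_iff) auto
  then show "A $$ (i, j) = 0\<^sub>m (dim_row A) (dim_col A) $$ (i, j)" using ij by simp
qed auto

text \<open>For \<open>C = A * (V - W)\<close> the hypothesis makes \<open>C^* C\<close> vanish,
  hence \<open>C\<close> itself.\<close>

lemma mat_adjoint_mult_cancel:
  assumes A: "(A :: complex mat) \<in> carrier_mat n m" and V: "V \<in> carrier_mat m k" and W: "W \<in> carrier_mat m k"
    and eq: "mat_adjoint A * A * V = mat_adjoint A * A * W"
  shows "A * V = A * W"
proof -
  let ?C = "A * (V - W)"
  have "mat_adjoint ?C * ?C = mat_adjoint (V - W) * (mat_adjoint A * A * (V - W))"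
    using A V W by (simp add: mat_adjoint_mult mult_mat_assoc del: assoc_mult_mat)
  also have "mat_adjoint A * A * (V - W) = mat_adjoint A * A * V - mat_adjoint A * A * W"
    using A V W by (intro mult_minus_distrib_mat[of _ m m _ k] mult_carrier_mat[of _ m n]) auto
  also have "\<dots> = 0\<^sub>m m k" unfolding eq using A W by (intro eq_matI) auto
  finally have "?C = 0\<^sub>m n k"
    using mat_adjoint_mult_self_eq_0[of ?C] A V W by simp
  then have D: "A * V - A * W = 0\<^sub>m n k"
    using A V W by (simp add: mult_minus_distrib_mat[of _ n m _ k])
  show ?thesis
  proof (rule eq_matI)
    fix i j assume "i < dim_row (A * W)" "j < dim_col (A * W)"
    then show "(A * V) $$ (i, j) = (A * W) $$ (i, j)"
      using A V W arg_cong[OF D, of "\<lambda>M. M $$ (i, j)"] by simp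
  qed (use A V W in auto)
qed

text \<open>Since \<open>A Y A X = A X\<close> and \<open>A X A Y = A Y\<close>, taking adjoints of
  these Hermitian projections gives \<open>A X = A Y\<close>, and likewise \<open>X A = Y A\<close>.
  Then \<open>X = X A X = X A Y = Y A Y = Y\<close>.\<close>

lemma is_moore_penrose_unique:
  assumes X: "is_moore_penrose A X" and Y: "is_moore_penrose A Y"
  shows "X = Y"
proof -
  have d: "dim_row X = dim_col A" "dim_col X = dim_row A" "dim_row Y = dim_col A" "dim_col Y = dim_row A"
    using X Y by (auto simp: is_moore_penrose_def)
  have x: "A * X * A = A" "X * A * X = X" "mat_adjoint (A * X) = A * X" "mat_adjoint (X * A) = X * A"
    and y: "A * Y * A = A" "Y * A * Y = Y" "mat_adjoint (A * Y) = A * Y" "mat_adjoint (Y * A) = Y * A"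
    using X Y by (simp_all add: is_moore_penrose_def)
  note ass = mult_mat_assoc
  have "A * X = A * Y * (A * X)" using d y(1) by (simp flip: ass del: assoc_mult_mat)
  also have "\<dots> = mat_adjoint (A * X * (A * Y))" using d by (simp add: mat_adjoint_mult[of "A * X"] x y)
  also have "A * X * (A * Y) = A * Y" using d x(1) by (simp flip: ass del: assoc_mult_mat)
  finally have AXY: "A * X = A * Y" by (simp only: y)
  have "X * A = X * A * (Y * A)" using d y(1) by (simp add: ass del: assoc_mult_mat)
  also have "\<dots> = mat_adjoint (Y * A * (X * A))" using d by (simp add: mat_adjoint_mult[of "Y * A"] x y)
  also have "Y * A * (X * A) = Y * A" using d x(1) by (simp add: ass del: assoc_mult_mat)
  finally have XYA: "X * A = Y * A" by (simp only: y)
  have "X = X * (A * X)" using d x(2) by (simp add: ass)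
  also have "\<dots> = X * A * Y" using d by (simp add: AXY ass)
  also have "\<dots> = Y" by (simp only: XYA y)
  finally show ?thesis .
qed

text \<open>The witness is \<open>D A\<^sup>*\<close> with \<open>D\<close> the Drazin inverse of the Hermitian matrix \<open>H = A\<^sup>* A\<close>:
  cancelling \<open>H\<^sup>* = H\<close> repeatedly from \<open>H\<^sup>k H D = H\<^sup>k\<close> leaves \<open>A H D = A\<close>.\<close>
lemma is_moore_penrose_exists: "\<exists>X. is_moore_penrose A X"
proof -
  define n where "n = dim_row A"
  define m where "m = dim_col A"
  have A: "A \<in> carrier_mat n m" by (simp add: n_def m_def)
  note ass = mult_mat_assoc
  define H where "H = mat_adjoint A * A"
  have H: "H \<in> carrier_mat m m"
    unfolding H_def using A by (intro mult_carrier_mat[of _ m n]) auto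
  have Hh: "mat_adjoint H = H" by (simp add: H_def mat_adjoint_mult)
  define D where "D = drazin H"
  let ?k = "mat_index H"
  have dD: "is_drazin H D" using is_drazin_drazin[OF H] by (simp add: D_def)
  then have D: "D \<in> carrier_mat m m" and DHD: "D * H * D = D" and HD: "H * D = D * H"
    and Hk: "H ^\<^sub>m Suc ?k * D = H ^\<^sub>m ?k"
    using H by (auto simp: is_drazin_def simp del: pow_mat.simps)
  \<comment> \<open>By uniqueness: the adjoint of \<open>D\<close> is again a Drazin inverse of the
    Hermitian matrix \<open>H\<close>.\<close>
  have Dh: "mat_adjoint D = D"
  proof (rule is_drazin_unique[OF H is_drazinI dD])
    show "mat_adjoint D * H * mat_adjoint D = mat_adjoint D"
      using arg_cong[OF DHD, of mat_adjoint] H D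
      by (simp add: mat_adjoint_mult Hh ass del: assoc_mult_mat)
    show comm: "H * mat_adjoint D = mat_adjoint D * H"
      using arg_cong[OF HD, of mat_adjoint] H D by (simp add: mat_adjoint_mult Hh)
    have "mat_adjoint D * H ^\<^sub>m Suc ?k = H ^\<^sub>m ?k"
      using arg_cong[OF Hk, of mat_adjoint] H D
      by (simp add: mat_adjoint_mult mat_adjoint_pow[OF H] Hh del: pow_mat.simps)
    moreover have "H ^\<^sub>m j * mat_adjoint D = mat_adjoint D * H ^\<^sub>m j" for j
    proof (induction j)
      case (Suc j)
      have "H ^\<^sub>m Suc j * mat_adjoint D = H ^\<^sub>m j * mat_adjoint D * H"
        using H D comm by (simp add: ass)
      then show ?case using H D by (simp add: Suc ass)
    qed (use H D in simp)
    ultimately show "H ^\<^sub>m Suc ?k * mat_adjoint D = H ^\<^sub>m ?k" by (simp only:)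
  qed (use H D in auto)
  have pow: "H ^\<^sub>m Suc j * V = H * (H ^\<^sub>m j * V)" if "V \<in> carrier_mat m m" for j V
    using that H by (simp only: pow_mat_Suc2[OF H]) (simp add: ass)
  \<comment> \<open>As \<open>H * H\<close> is \<open>H^* H\<close>, cancellation removes one factor
    \<open>H\<close> at a time until a single one is left.\<close>
  have descend: "H * V = H * W"
    if "V \<in> carrier_mat m m" "W \<in> carrier_mat m m" "H ^\<^sub>m Suc j * V = H ^\<^sub>m Suc j * W" for j V W
    using that(3)
  proof (induction j)
    case (Suc j)
    let ?V = "H ^\<^sub>m j * V" and ?W = "H ^\<^sub>m j * W"
    have "mat_adjoint H * H * ?V = H ^\<^sub>m Suc (Suc j) * V" "mat_adjoint H * H * ?W = H ^\<^sub>m Suc (Suc j) * W"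
      using that(1,2) H by (simp_all only: pow Hh) (simp_all add: ass)
    then have "mat_adjoint H * H * ?V = mat_adjoint H * H * ?W" by (simp only: Suc.prems)
    then have "H * ?V = H * ?W"
      using H that(1,2) by (intro mat_adjoint_mult_cancel[OF H, of _ m]) auto
    then show ?case using Suc.IH that(1,2) by (simp only: pow)
  qed (use H in simp)
  have "H ^\<^sub>m Suc ?k * (H * D) = H * (H ^\<^sub>m Suc ?k * D)"
    using pow[of "H * D" ?k] H D by (simp add: ass)
  also have "\<dots> = H ^\<^sub>m Suc ?k" by (simp only: Hk pow_mat_Suc2[OF H, symmetric])
  also have "\<dots> = H ^\<^sub>m Suc ?k * 1\<^sub>m m" using H by (simp del: pow_mat.simps)
  finally have "H * (H * D) = H * 1\<^sub>m m"
    by (rule descend[OF mult_carrier_mat[OF H D] one_carrier_mat])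
  \<comment> \<open>The last \<open>H\<close> on the left is \<open>A^* A\<close>, and cancelling
    its adjoint factor leaves \<open>A\<close>.\<close>
  then have "A * (H * D) = A * 1\<^sub>m m"
    unfolding H_def[symmetric]
    by (intro mat_adjoint_mult_cancel[OF A, folded H_def, of _ m] mult_carrier_mat[OF H D] one_carrier_mat)
  then have AHD: "A * (H * D) = A" using A by simp
  have "is_moore_penrose A (D * mat_adjoint A)"
    unfolding is_moore_penrose_def
  proof (intro conjI)
    show "D * mat_adjoint A \<in> carrier_mat (dim_col A) (dim_row A)" using A D by auto
    have XA: "D * mat_adjoint A * A = D * H" using A D by (simp add: H_def ass)
    have "A * (D * mat_adjoint A) * A = A * (D * mat_adjoint A * A)" using A D by (simp add: ass)
    then show "A * (D * mat_adjoint A) * A = A" by (simp only: XA HD[symmetric] AHD)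
    have "D * mat_adjoint A * A * (D * mat_adjoint A) = D * H * (D * mat_adjoint A)" by (simp only: XA)
    also have "\<dots> = D * H * D * mat_adjoint A" using A D H by (simp add: ass)
    finally have "D * mat_adjoint A * A * (D * mat_adjoint A) = D * H * D * mat_adjoint A" .
    then show "D * mat_adjoint A * A * (D * mat_adjoint A) = D * mat_adjoint A" by (simp only: DHD)
    show "mat_adjoint (A * (D * mat_adjoint A)) = A * (D * mat_adjoint A)"
      using A D by (simp add: mat_adjoint_mult Dh ass)
    show "mat_adjoint (D * mat_adjoint A * A) = D * mat_adjoint A * A"
      unfolding XA using D H HD by (subst mat_adjoint_mult) (auto simp only: carrier_matD Dh Hh)
  qed
  then show ?thesis by blast
qed

lemma moore_penrose_eqI: "is_moore_penrose A X \<Longrightarrow> moore_penrose A = X"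
  unfolding moore_penrose_def using is_moore_penrose_unique by blast

lemma is_moore_penrose_moore_penrose: "is_moore_penrose A (moore_penrose A)"
  using is_moore_penrose_exists[of A] moore_penrose_eqI by auto

text \<open>The factors \<open>E^* E\<close> and \<open>F^* F\<close> disappear from all products,
  so each Penrose equation is the one for \<open>T\<close> placed between isometries.\<close>

lemma moore_penrose_isometries:
  assumes E: "E \<in> carrier_mat n r" and EE: "mat_adjoint E * E = 1\<^sub>m r"
    and F: "F \<in> carrier_mat m s" and FF: "mat_adjoint F * F = 1\<^sub>m s"
    and T: "T \<in> carrier_mat r s"
  shows "moore_penrose (E * T * mat_adjoint F) = F * moore_penrose T * mat_adjoint E"
proof (rule moore_penrose_eqI)
  let ?X = "moore_penrose T" and ?E = "mat_adjoint E" and ?F = "mat_adjoint F"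
  have X: "?X \<in> carrier_mat s r" and x: "T * ?X * T = T" "?X * T * ?X = ?X"
    "mat_adjoint (T * ?X) = T * ?X" "mat_adjoint (?X * T) = ?X * T"
    using is_moore_penrose_moore_penrose[of T] T by (auto simp: is_moore_penrose_def)
  note d = E F T X mult_mat_assoc
  have E1: "?E * (E * B) = B" if "dim_row B = r" for B
    using that E EE by (simp flip: mult_mat_assoc)
  have F1: "?F * (F * B) = B" if "dim_row B = s" for B
    using that F FF by (simp flip: mult_mat_assoc)
  note x' = x[unfolded mult_mat_assoc]
  have TX: "E * T * ?F * (F * ?X * ?E) = E * (T * ?X) * ?E"
    using d by (simp add: mult_mat_assoc F1 del: assoc_mult_mat)
  have XT: "F * ?X * ?E * (E * T * ?F) = F * (?X * T) * ?F"
    using d by (simp add: mult_mat_assoc E1 del: assoc_mult_mat)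
  have 1: "E * T * ?F * (F * ?X * ?E) * (E * T * ?F) = E * (T * ?X * T) * ?F"
    unfolding TX using d by (simp add: mult_mat_assoc E1 F1 del: assoc_mult_mat)
  have 2: "F * ?X * ?E * (E * T * ?F) * (F * ?X * ?E) = F * (?X * T * ?X) * ?E"
    unfolding XT using d by (simp add: mult_mat_assoc F1 del: assoc_mult_mat)
  have penrose: "E * T * ?F * (F * ?X * ?E) * (E * T * ?F) = E * T * ?F"
    "F * ?X * ?E * (E * T * ?F) * (F * ?X * ?E) = F * ?X * ?E"
    by (simp_all only: 1 2 x)
  have 3: "mat_adjoint (E * B * ?E) = E * mat_adjoint B * ?E" if "B \<in> carrier_mat r r" for B
    using that E by (simp add: mat_adjoint_mult mult_mat_assoc)
  have 4: "mat_adjoint (F * B * ?F) = F * mat_adjoint B * ?F" if "B \<in> carrier_mat s s" for B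
    using that F by (simp add: mat_adjoint_mult mult_mat_assoc)
  show "is_moore_penrose (E * T * ?F) (F * ?X * ?E)"
    unfolding is_moore_penrose_def penrose
    using mult_carrier_mat[OF mult_carrier_mat[OF F X] mat_adjoint_carrier[OF E]]
    unfolding TX XT using E F T X x by (simp add: 3 4 del: assoc_mult_mat)
qed

lemma moore_penrose_inverse:
  assumes "S \<in> carrier_mat r r" "S' \<in> carrier_mat r r" "S * S' = 1\<^sub>m r" "S' * S = 1\<^sub>m r"
  shows "moore_penrose S = S'"
  using assms by (intro moore_penrose_eqI) (simp add: is_moore_penrose_def)

section \<open>Hartwig-Spindelboeck decompositions\<close>

text \<open>Induction on the blocks: the first one splits off as a corner of a 2 by 2 block diagonal
  matrix, and the products are formed blockwise.\<close>

lemma scalar_diag_block_inverse: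
  fixes bs :: "('a :: field \<times> nat) list"
  assumes "\<forall>(s, k) \<in> set bs. s \<noteq> 0"
  defines "d \<equiv> sum_list (map snd bs)"
  shows "diag_block_mat (map (\<lambda>(s, k). s \<cdot>\<^sub>m 1\<^sub>m k) bs) \<in> carrier_mat d d"
    and "diag_block_mat (map (\<lambda>(s, k). inverse s \<cdot>\<^sub>m 1\<^sub>m k) bs) \<in> carrier_mat d d"
    and "diag_block_mat (map (\<lambda>(s, k). s \<cdot>\<^sub>m 1\<^sub>m k) bs)
      * diag_block_mat (map (\<lambda>(s, k). inverse s \<cdot>\<^sub>m 1\<^sub>m k) bs) = 1\<^sub>m d"
    and "diag_block_mat (map (\<lambda>(s, k). inverse s \<cdot>\<^sub>m 1\<^sub>m k) bs)
      * diag_block_mat (map (\<lambda>(s, k). s \<cdot>\<^sub>m 1\<^sub>m k) bs) = 1\<^sub>m d"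
proof -
  have *: "diag_block_mat (map (\<lambda>(s, k). s \<cdot>\<^sub>m 1\<^sub>m k) cs) \<in> carrier_mat d d \<and>
    diag_block_mat (map (\<lambda>(s, k). inverse s \<cdot>\<^sub>m 1\<^sub>m k) cs) \<in> carrier_mat d d \<and>
    diag_block_mat (map (\<lambda>(s, k). s \<cdot>\<^sub>m 1\<^sub>m k) cs)
      * diag_block_mat (map (\<lambda>(s, k). inverse s \<cdot>\<^sub>m 1\<^sub>m k) cs) = 1\<^sub>m d \<and>
    diag_block_mat (map (\<lambda>(s, k). inverse s \<cdot>\<^sub>m 1\<^sub>m k) cs)
      * diag_block_mat (map (\<lambda>(s, k). s \<cdot>\<^sub>m 1\<^sub>m k) cs) = 1\<^sub>m d"
    if "\<forall>(s, k) \<in> set cs. s \<noteq> 0" "d = sum_list (map snd cs)" for cs :: "('a \<times> nat) list" and d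
    using that
  proof (induction cs arbitrary: d)
    case (Cons c cs)
    obtain s k where c: "c = (s, k)" by force
    let ?e = "sum_list (map snd cs)"
    let ?f = "diag_block_mat (map (\<lambda>(s, k). s \<cdot>\<^sub>m 1\<^sub>m k) cs)"
    let ?g = "diag_block_mat (map (\<lambda>(s, k). inverse s \<cdot>\<^sub>m 1\<^sub>m k) cs)"
    have IH: "?f \<in> carrier_mat ?e ?e" "?g \<in> carrier_mat ?e ?e" "?f * ?g = 1\<^sub>m ?e" "?g * ?f = 1\<^sub>m ?e"
      using Cons by auto
    have s: "s \<noteq> 0" using Cons.prems by (auto simp: c)
    have ss: "(a \<cdot>\<^sub>m 1\<^sub>m k) * (b \<cdot>\<^sub>m 1\<^sub>m k) = 1\<^sub>m k" if "b * a = 1" for a b :: 'a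
    proof -
      have "(a \<cdot>\<^sub>m 1\<^sub>m k) * (b \<cdot>\<^sub>m 1\<^sub>m k) = b \<cdot>\<^sub>m (a \<cdot>\<^sub>m 1\<^sub>m k)"
        by (simp add: mult_smult_distrib[of _ k k _ k])
      also have "\<dots> = 1\<^sub>m k" using that by (intro eq_matI) auto
      finally show ?thesis .
    qed
    have prod: "four_block_mat (a \<cdot>\<^sub>m 1\<^sub>m k) (0\<^sub>m k ?e) (0\<^sub>m ?e k) u * four_block_mat (b \<cdot>\<^sub>m 1\<^sub>m k) (0\<^sub>m k ?e) (0\<^sub>m ?e k) v
      = 1\<^sub>m (k + ?e)" if "b * a = 1" "u \<in> carrier_mat ?e ?e" "v \<in> carrier_mat ?e ?e" "u * v = 1\<^sub>m ?e" for a b :: 'a and u v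
      using that by (subst mult_four_block_mat[of _ k k _ ?e _ ?e _ _ k _ ?e]) (simp_all add: ss)
    have "inverse s * s = 1" "s * inverse s = 1" using s by simp_all
    then show ?case
      using IH Cons.prems(2) prod[of "inverse s" s ?f ?g] prod[of s "inverse s" ?g ?f]
      by (auto simp: c Let_def)
  qed auto
  show "diag_block_mat (map (\<lambda>(s, k). s \<cdot>\<^sub>m 1\<^sub>m k) bs) \<in> carrier_mat d d"
    and "diag_block_mat (map (\<lambda>(s, k). inverse s \<cdot>\<^sub>m 1\<^sub>m k) bs) \<in> carrier_mat d d"
    and "diag_block_mat (map (\<lambda>(s, k). s \<cdot>\<^sub>m 1\<^sub>m k) bs)
      * diag_block_mat (map (\<lambda>(s, k). inverse s \<cdot>\<^sub>m 1\<^sub>m k) bs) = 1\<^sub>m d"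
    and "diag_block_mat (map (\<lambda>(s, k). inverse s \<cdot>\<^sub>m 1\<^sub>m k) bs)
      * diag_block_mat (map (\<lambda>(s, k). s \<cdot>\<^sub>m 1\<^sub>m k) bs) = 1\<^sub>m d"
    using *[of bs d] assms by simp_all
qed

lemma singular_value_diag_inverse:
  assumes "is_singular_value_diag A S" and S: "S \<in> carrier_mat r r"
  obtains S' where "S' \<in> carrier_mat r r" "S * S' = 1\<^sub>m r" "S' * S = 1\<^sub>m r"
proof -
  obtain bs :: "(real \<times> nat) list" where pos: "\<forall>(s, k) \<in> set bs. s > 0 \<and> k > 0"
    and bs: "S = diag_block_mat (map (\<lambda>(s, k). complex_of_real s \<cdot>\<^sub>m 1\<^sub>m k) bs)"
    using assms(1) unfolding is_singular_value_diag_def by blast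
  define cs where "cs = map (\<lambda>(s, k). (complex_of_real s, k)) bs"
  have cs: "\<forall>(s, k) \<in> set cs. s \<noteq> 0" using pos by (auto simp: cs_def)
  have Scs: "S = diag_block_mat (map (\<lambda>(s, k). s \<cdot>\<^sub>m 1\<^sub>m k) cs)"
    by (simp add: bs cs_def o_def case_prod_unfold)
  note inv = scalar_diag_block_inverse[OF cs, folded Scs]
  \<comment> \<open>The matrix \<open>S\<close> lies in both carriers, which forces the block sizes
    to add up to \<open>r\<close>.\<close>
  have "sum_list (map snd cs) = r" using inv(1) S by auto
  then show ?thesis using inv(2-) that by simp
qed

text \<open>Blocks with no rows or no columns encode the partitions \<open>(E G)\<close> and its
  stacked counterpart as four-block matrices, so block multiplication applies to them.\<close>

lemma four_block_mult_adjoint: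
  assumes E: "E \<in> carrier_mat n r" and G: "G \<in> carrier_mat n m"
    and E': "E' \<in> carrier_mat r n" and G': "G' \<in> carrier_mat m n"
    and X: "X \<in> carrier_mat r r" and Y: "Y \<in> carrier_mat r m"
    and Z: "Z \<in> carrier_mat m r" and W: "W \<in> carrier_mat m m"
  shows "four_block_mat E G (0\<^sub>m 0 r) (0\<^sub>m 0 m) * four_block_mat X Y Z W * four_block_mat E' (0\<^sub>m r 0) G' (0\<^sub>m m 0)
    = (E * X + G * Z) * E' + (E * Y + G * W) * G'" (is "?L = ?R")
proof -
  let ?M = "E * X + G * Z" and ?N = "E * Y + G * W"
  have M: "?M \<in> carrier_mat n r" and N: "?N \<in> carrier_mat n m" using assms by auto
  have "four_block_mat E G (0\<^sub>m 0 r) (0\<^sub>m 0 m) * four_block_mat X Y Z W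
      = four_block_mat ?M ?N (0\<^sub>m 0 r) (0\<^sub>m 0 m)"
    unfolding mult_four_block_mat[OF E G zero_carrier_mat zero_carrier_mat X Y Z W]
    by (intro arg_cong2[where f = "four_block_mat ?M ?N"] eq_matI) (use assms in auto)
  moreover have "four_block_mat ?M ?N (0\<^sub>m 0 r) (0\<^sub>m 0 m) * four_block_mat E' (0\<^sub>m r 0) G' (0\<^sub>m m 0) = ?R"
    unfolding mult_four_block_mat[OF M N zero_carrier_mat zero_carrier_mat E' zero_carrier_mat G' zero_carrier_mat]
    using M N E' G' by (intro eq_matI) simp_all
  ultimately show ?thesis by (simp only:)
qed

text \<open>\<open>E\<close> and \<open>G\<close> are the column blocks of \<open>U\<close>, and
  \<open>F\<close> is \<open>U\<close> times the adjoint of the row \<open>(Q P)\<close>. Unitarity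
  of \<open>U\<close> gives the relations of \<open>E\<close> and \<open>G\<close>; \<open>F\<close>
  is an isometry because \<open>Q Q^* + P P^*\<close> is the identity.\<close>

lemma hartwig_spindelboeck_isometries:
  assumes hs: "hartwig_spindelboeck n r A U S Q P" and rn: "r \<le> n"
  obtains E F G where "E \<in> carrier_mat n r" "F \<in> carrier_mat n r" "G \<in> carrier_mat n (n - r)"
    "mat_adjoint E * E = 1\<^sub>m r" "mat_adjoint F * F = 1\<^sub>m r" "mat_adjoint E * G = 0\<^sub>m r (n - r)"
    "E * mat_adjoint E + G * mat_adjoint G = 1\<^sub>m n"
    "mat_adjoint F * E = Q" "mat_adjoint F * G = P" "A = E * S * mat_adjoint F"
proof -
  define m where "m = n - r"
  have n: "n = r + m" using rn by (simp add: m_def)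
  have U: "U \<in> carrier_mat n n" and UU: "U * mat_adjoint U = 1\<^sub>m n" "mat_adjoint U * U = 1\<^sub>m n"
    and S: "S \<in> carrier_mat r r" and Q: "Q \<in> carrier_mat r r" and P: "P \<in> carrier_mat r m"
    and QP: "Q * mat_adjoint Q + P * mat_adjoint P = 1\<^sub>m r"
    and A: "A = U * four_block_mat (S * Q) (S * P) (0\<^sub>m m r) (0\<^sub>m m m) * mat_adjoint U"
    using hs by (auto simp: hartwig_spindelboeck_def unitary_mat_def m_def)
  define E where "E = mat n r (\<lambda>(i, j). U $$ (i, j))"
  define G where "G = mat n m (\<lambda>(i, j). U $$ (i, j + r))"
  define F where "F = E * mat_adjoint Q + G * mat_adjoint P"
  let ?E = "mat_adjoint E" and ?F = "mat_adjoint F" and ?G = "mat_adjoint G"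
  have E: "E \<in> carrier_mat n r" and G: "G \<in> carrier_mat n m" by (simp_all add: E_def G_def)
  have F: "F \<in> carrier_mat n r" using E G Q P by (auto simp: F_def)
  note car = E F G S Q P
  have UE: "U = four_block_mat E G (0\<^sub>m 0 r) (0\<^sub>m 0 m)"
    using U by (intro eq_matI) (auto simp: E_def G_def n)
  have UE': "mat_adjoint U = four_block_mat ?E (0\<^sub>m r 0) ?G (0\<^sub>m m 0)"
    using U by (intro eq_matI) (auto simp: E_def G_def n)
  \<comment> \<open>Orthonormality of the columns of \<open>U\<close>, entry by entry, from which
    the four block products are read off.\<close>
  have ent: "(\<Sum>k = 0..<n. cnj (U $$ (k, i)) * U $$ (k, j)) = (if i = j then 1 else 0)"
    if "i < n" "j < n" for i j
    using that U arg_cong[OF UU(2), of "\<lambda>M. M $$ (i, j)"] by (simp add: scalar_prod_def)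
  have bounds: "i < r \<Longrightarrow> i < n" "j < m \<Longrightarrow> j + r < n" for i j
    by (auto simp: n)
  have EE: "?E * E = 1\<^sub>m r" and EG: "?E * G = 0\<^sub>m r m" and GE: "?G * E = 0\<^sub>m m r" and GG: "?G * G = 1\<^sub>m m"
    by (auto intro!: eq_matI simp: E_def G_def scalar_prod_def ent bounds)
  have one: "1\<^sub>m n = four_block_mat (1\<^sub>m r) (0\<^sub>m r m) (0\<^sub>m m r) (1\<^sub>m m)"
    by (intro eq_matI) (auto simp: n)
  \<comment> \<open>With the identity as middle factor, the block formula turns \<open>U U^*\<close>
    into \<open>E E^* + G G^*\<close>.\<close>
  have "U * 1\<^sub>m n * mat_adjoint U
      = (E * 1\<^sub>m r + G * 0\<^sub>m m r) * ?E + (E * 0\<^sub>m r m + G * 1\<^sub>m m) * ?G"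
    unfolding UE' one unfolding UE using car by (intro four_block_mult_adjoint) auto
  also have "\<dots> = E * ?E + G * ?G" using E G by simp
  finally have res: "E * ?E + G * ?G = 1\<^sub>m n" using U UU by simp
  have F': "?F = Q * ?E + P * ?G" using car by (simp add: F_def mat_adjoint_add mat_adjoint_mult)
  note ass = mult_mat_assoc
  have FE: "?F * E = Q"
    using car by (simp add: F' add_mult_distrib_mat[of _ r n _ _ r] ass EE GE)
  have FG: "?F * G = P"
    using car by (simp add: F' add_mult_distrib_mat[of _ r n _ _ m] ass EG GG)
  have "?F * F = ?F * E * mat_adjoint Q + ?F * G * mat_adjoint P"
    using car by (subst (2) F_def) (simp add: mult_add_distrib_mat[of _ r n _ r] ass)
  then have FF: "?F * F = 1\<^sub>m r" by (simp only: FE FG QP)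
  have "A = (E * (S * Q) + G * 0\<^sub>m m r) * ?E + (E * (S * P) + G * 0\<^sub>m m m) * ?G"
    unfolding A UE' unfolding UE using car by (intro four_block_mult_adjoint) auto
  also have "\<dots> = E * (S * Q) * ?E + E * (S * P) * ?G"
    using car by simp
  also have "\<dots> = E * S * (Q * ?E + P * ?G)"
    using car by (simp add: ass mult_add_distrib_mat[of _ n r _ n] mult_add_distrib_mat[of _ r r _ n])
  finally have "A = E * S * ?F" by (simp only: F')
  then show ?thesis
    using that[of E F G] E F G EE FF EG res FE FG by (simp add: m_def)
qed

text \<open>The Moore-Penrose inverse of \<open>F T E^*\<close> is \<open>E X F^*\<close> with
  \<open>X\<close> that of \<open>T\<close>, so the two products to compare are
  \<open>F \<Delta> F^*\<close> and \<open>E \<Gamma> E^*\<close> with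
  \<open>\<Gamma> = X T\<close>.\<close>

lemma EP_iff:
  assumes E: "E \<in> carrier_mat n r" and F: "F \<in> carrier_mat n r" and G: "G \<in> carrier_mat n m"
    and EE: "mat_adjoint E * E = 1\<^sub>m r" and FF: "mat_adjoint F * F = 1\<^sub>m r"
    and EG: "mat_adjoint E * G = 0\<^sub>m r m" and res: "E * mat_adjoint E + G * mat_adjoint G = 1\<^sub>m n"
    and T: "T \<in> carrier_mat r r"
  defines "Q \<equiv> mat_adjoint F * E" and "P \<equiv> mat_adjoint F * G" and "\<Delta> \<equiv> T * moore_penrose T"
  shows "EP_mat (F * T * mat_adjoint E) \<longleftrightarrow>
    mat_adjoint Q * \<Delta> * Q = moore_penrose T * T \<and> \<Delta> * P = 0\<^sub>m r m"
proof -
  let ?E = "mat_adjoint E" and ?F = "mat_adjoint F" and ?G = "mat_adjoint G" and ?X = "moore_penrose T"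
  define \<Gamma> where "\<Gamma> = ?X * T"
  have X: "?X \<in> carrier_mat r r" and \<Delta>h: "mat_adjoint \<Delta> = \<Delta>"
    using is_moore_penrose_moore_penrose[of T] T by (auto simp: is_moore_penrose_def \<Delta>_def)
  have Q: "Q \<in> carrier_mat r r" and P: "P \<in> carrier_mat r m"
    using E F G by (auto simp: Q_def P_def intro!: mult_carrier_mat[of _ r n])
  have \<Delta>: "\<Delta> \<in> carrier_mat r r" and \<Gamma>: "\<Gamma> \<in> carrier_mat r r" using T X by (auto simp: \<Delta>_def \<Gamma>_def)
  note car = E F G T X Q P \<Delta> \<Gamma>
  note ass = mult_mat_assoc
  have mp: "moore_penrose (F * T * ?E) = E * ?X * ?F"
    by (rule moore_penrose_isometries[OF F FF E EE T])
  have E1: "?E * (E * B) = B" if "dim_row B = r" for B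
    using that E EE by (simp flip: ass)
  have F1: "?F * (F * B) = B" if "dim_row B = r" for B
    using that F FF by (simp flip: ass)
  have Q': "mat_adjoint Q = ?E * F" using car by (simp add: Q_def mat_adjoint_mult)
  have l: "F * T * ?E * (E * ?X * ?F) = F * \<Delta> * ?F"
    using car by (simp add: \<Delta>_def ass E1 del: assoc_mult_mat)
  have r: "E * ?X * ?F * (F * T * ?E) = E * \<Gamma> * ?E"
    using car by (simp add: \<Gamma>_def ass F1 del: assoc_mult_mat)
  have "EP_mat (F * T * ?E) \<longleftrightarrow> F * \<Delta> * ?F = E * \<Gamma> * ?E"
    using car unfolding EP_mat_def mp l r by simp
  also have "\<dots> \<longleftrightarrow> mat_adjoint Q * \<Delta> * Q = \<Gamma> \<and> \<Delta> * P = 0\<^sub>m r m"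
  proof
    assume eq: "F * \<Delta> * ?F = E * \<Gamma> * ?E"
    have "mat_adjoint Q * \<Delta> * Q = ?E * (F * \<Delta> * ?F) * E"
      unfolding Q' unfolding Q_def using car by (simp add: ass del: assoc_mult_mat)
    also have "\<dots> = ?E * (E * \<Gamma> * ?E) * E" by (simp only: eq)
    also have "\<dots> = \<Gamma>" using car by (simp add: ass E1 EE del: assoc_mult_mat)
    finally have 1: "mat_adjoint Q * \<Delta> * Q = \<Gamma>" .
    have "\<Delta> * P = ?F * (F * \<Delta> * ?F) * G"
      unfolding P_def using car by (simp add: ass F1 del: assoc_mult_mat)
    also have "\<dots> = ?F * (E * \<Gamma> * ?E) * G" by (simp only: eq)
    also have "\<dots> = 0\<^sub>m r m" using car by (simp add: ass EG del: assoc_mult_mat)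
    finally show "mat_adjoint Q * \<Delta> * Q = \<Gamma> \<and> \<Delta> * P = 0\<^sub>m r m" using 1 by simp
  next
    assume h: "mat_adjoint Q * \<Delta> * Q = \<Gamma> \<and> \<Delta> * P = 0\<^sub>m r m"
    \<comment> \<open>Inserting the identity splits \<open>F^*\<close> into
      \<open>Q E^* + P G^*\<close>, and \<open>\<Delta>\<close> annihilates the second term.\<close>
    have "\<Delta> * ?F = \<Delta> * ?F * (E * ?E + G * ?G)" using car by (simp add: res)
    also have "\<dots> = \<Delta> * Q * ?E + \<Delta> * P * ?G"
      using car by (simp add: mult_add_distrib_mat[of _ r n _ n] Q_def P_def ass del: assoc_mult_mat)
    also have "\<dots> = \<Delta> * Q * ?E + 0\<^sub>m r m * ?G" by (simp only: conjunct2[OF h])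
    also have "\<dots> = \<Delta> * Q * ?E"
      using mult_carrier_mat[OF mult_carrier_mat[OF \<Delta> Q] mat_adjoint_carrier[OF E]] G by simp
    finally have 1: "\<Delta> * ?F = \<Delta> * Q * ?E" .
    \<comment> \<open>The adjoint of the previous equation, as \<open>\<Delta>\<close> is
      Hermitian.\<close>
    have 2: "F * \<Delta> = E * mat_adjoint Q * \<Delta>"
      using arg_cong[OF 1, of mat_adjoint] car by (simp add: mat_adjoint_mult \<Delta>h ass del: assoc_mult_mat)
    have "F * \<Delta> * ?F = F * \<Delta> * Q * ?E" using car 1 by (simp add: ass del: assoc_mult_mat)
    also have "\<dots> = E * (mat_adjoint Q * \<Delta> * Q) * ?E"
      unfolding 2 using car by (simp add: ass del: assoc_mult_mat)
    finally show "F * \<Delta> * ?F = E * \<Gamma> * ?E" using h by simp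
  qed
  finally show ?thesis by (simp only: \<Gamma>_def)
qed

theorem theorem10:
  fixes n r :: nat
    and A U \<Sigma> Q P \<Sigma>t \<Delta> :: "complex mat"
  assumes "A \<in> carrier_mat n n"
    and "mat_rank A = r"
    and "r > 0"
    and "hartwig_spindelboeck n r A U \<Sigma> Q P"
    and "\<Sigma>t = Q * drazin (\<Sigma> * Q) * (drazin (\<Sigma> * Q) ^\<^sub>m 2)"
    and "\<Delta> = \<Sigma>t * moore_penrose \<Sigma>t"
  shows "EP_mat (mpdmp A) \<longleftrightarrow>
    mat_adjoint Q * \<Delta> * Q = moore_penrose \<Sigma>t * \<Sigma>t \<and> \<Delta> * P = 0\<^sub>m r (n - r)"
proof -
  \<comment> \<open>Ensures that the truncated subtraction \<open>n - r\<close> is the true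
    difference.\<close>
  have rn: "r \<le> n" using vec_space.rank_le_nc[of A n n] assms(1,2) by auto
  have \<Sigma>: "\<Sigma> \<in> carrier_mat r r" and Q: "Q \<in> carrier_mat r r" and sv: "is_singular_value_diag A \<Sigma>"
    using assms(4) by (auto simp: hartwig_spindelboeck_def)
  obtain \<Sigma>' where \<Sigma>': "\<Sigma>' \<in> carrier_mat r r" "\<Sigma> * \<Sigma>' = 1\<^sub>m r" "\<Sigma>' * \<Sigma> = 1\<^sub>m r"
    using singular_value_diag_inverse[OF sv \<Sigma>] .
  obtain E F G where E: "E \<in> carrier_mat n r" and F: "F \<in> carrier_mat n r" and G: "G \<in> carrier_mat n (n - r)"
    and EE: "mat_adjoint E * E = 1\<^sub>m r" and FF: "mat_adjoint F * F = 1\<^sub>m r"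
    and EG: "mat_adjoint E * G = 0\<^sub>m r (n - r)"
    and res: "E * mat_adjoint E + G * mat_adjoint G = 1\<^sub>m n"
    and FE: "mat_adjoint F * E = Q" and FG: "mat_adjoint F * G = P" and A: "A = E * \<Sigma> * mat_adjoint F"
    by (rule hartwig_spindelboeck_isometries[OF assms(4) rn])
  let ?E = "mat_adjoint E" and ?F = "mat_adjoint F"
  define D where "D = drazin (\<Sigma> * Q)"
  have D: "D \<in> carrier_mat r r" and BD: "\<Sigma> * Q * D = D * (\<Sigma> * Q)" and DBD: "D * (\<Sigma> * Q) * D = D"
    using is_drazin_drazin[of "\<Sigma> * Q" r] \<Sigma> Q by (auto simp: is_drazin_def D_def)
  note car = E F \<Sigma> \<Sigma>'(1) Q D
  note ass = mult_mat_assoc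
  have E1: "?E * (E * B) = B" if "dim_row B = r" for B
    using that E EE by (simp flip: ass)
  have F1: "?F * (F * B) = B" if "dim_row B = r" for B
    using that F FF by (simp flip: ass)
  have \<Sigma>1: "\<Sigma>' * (\<Sigma> * B) = B" "\<Sigma> * (\<Sigma>' * B) = B" if "dim_row B = r" for B
    using that car \<Sigma>' by (simp_all flip: ass)
  have T: "\<Sigma>t = Q * D * (D * D)"
    using D by (simp add: assms(5) numeral_2_eq_2 flip: D_def)
  have mpA: "moore_penrose A = F * \<Sigma>' * ?E"
    unfolding A moore_penrose_isometries[OF E EE F FF \<Sigma>] moore_penrose_inverse[OF \<Sigma> \<Sigma>'] ..
  \<comment> \<open>Grouped this way, the swapped product \<open>\<Sigma> F^* E\<close> is
    \<open>\<Sigma> Q\<close>, the matrix whose Drazin inverse is \<open>D\<close>.\<close>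
  have "A = E * (\<Sigma> * ?F)" using car by (simp add: A ass)
  then have dA: "drazin A = E * (D * D) * (\<Sigma> * ?F)"
    using drazin_mult_swap[of E n r "\<Sigma> * ?F"] car by (simp add: ass FE D_def)
  have "mpdmp A = F * (\<Sigma>' * (D * D)) * ?E"
    unfolding mpdmp_def mpA dA using car by (simp add: ass E1 F1 \<Sigma>1 del: assoc_mult_mat)
  \<comment> \<open>From \<open>D = D (\<Sigma> Q) D = \<Sigma> Q D D\<close>; the leading
    \<open>\<Sigma>\<close> is produced in order to cancel \<open>\<Sigma>'\<close>.\<close>
  also have "D * D = \<Sigma> * Q * D * D * D"
    using BD DBD by (simp only:)
  also have "\<Sigma>' * (\<Sigma> * Q * D * D * D) = \<Sigma>t"
    using car by (simp add: T ass \<Sigma>1 del: assoc_mult_mat)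
  finally have M: "mpdmp A = F * \<Sigma>t * ?E" .
  have "\<Sigma>t \<in> carrier_mat r r" using Q D by (auto simp: T)
  from EP_iff[OF E F G EE FF EG res this] show ?thesis
    unfolding M FE FG assms(6) .
qed

end
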